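(* Let $V$ be a module over the linear space $W$ admitting a multiplicative basis $\mathfrak{B}=\{v_i\}_{i\in I}$ respect to a fixed basis $\mathfrak{B}'=\{w_j\}_{j\in J}$ of $W$. Let $\sim$ be the connection equivalence relation on $I$ and, for $[i]\in I/\sim$, let $V_{[i]}:=\bigoplus_{j\in[i]}\mathbb{F}v_j$. Then $$V=\bigoplus_{[i]\in I/\sim}V_{[i]},$$ where every $V_{[i]}\subset V$ is a submodule admitting the multiplicative basis $\mathfrak{B}_{[i]}:=\{v_j : j\in[i]\}$ inherited from $\mathfrak{B}$.
   Context: $\mathbb{F}$ is an arbitrary field; $V$ and $W$ are $\mathbb{F}$-linear spaces of arbitrary (possibly infinite) dimension. $V$ is a module over the linear space $W$ if it is endowed with a bilinear map $V\times W\to V$, $(v,w)\mapsto vw$ (no further axioms). A submodule of $V$ is a linear subspace $Y\subset V$ with $YW\subset Y$. Given a basis $\mathfrak{B}'=\{w_j\}_{j\in J}$ of $W$, a basis $\mathfrak{B}=\{v_i\}_{i\in I}$ of $V$ is multiplicative respect to $\mathfrak{B}'$ if for any $i\in I$, $j\in J$ either $v_iw_j=0$ or $0\neq v_iw_j\in\mathbb{F}v_k$ for some (unique) $k\in I$. A submodule $Y\subset V$ admits a multiplicative basis $\mathfrak{B}_Y$ inherited from $\mathfrak{B}$ if $\mathfrak{B}_Y$ is a multiplicative basis of $Y$ with $\mathfrak{B}_Y\subset\mathfrak{B}$. For each $j\in J$ introduce a new symbol $\overline{j}\notin J$, put $\overline{J}:=\{\overline{j}: j\in J\}$ and $\overline{(\overline{j})}:=j$.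 Let $\mathcal{P}(I)$ be the power set of $I$. Define $\star: I\times(J\,\dot\cup\,\overline{J})\to\mathcal{P}(I)$ as follows: for $i\in I$, $j\in J$, $i\star j:=\emptyset$ if $v_iw_j=0$, and $i\star j:=\{k\}$ if $0\neq v_iw_j\in\mathbb{F}v_k$; for $i\in I$, $\overline{j}\in\overline{J}$, $i\star\overline{j}:=\{k\in I: 0\neq v_kw_j\in\mathbb{F}v_i\}$. Define $\phi:\mathcal{P}(I)\times(J\,\dot\cup\,\overline{J})\to\mathcal{P}(I)$ by $\phi(U,j):=\bigcup_{i\in U}(i\star j)$. For $i\neq k$ in $I$, a connection from $i$ to $k$ is a finite sequence $\{j_1,\dots,j_n\}$ ($n\geq 1$) of elements of $J\,\dot\cup\,\overline{J}$ such that, with $U_0:=\{i\}$ and $U_m:=\phi(U_{m-1},j_m)$ for $1\le m\le n$: (1) $U_1,\dots,U_{n-1}$ are all nonempty; (2) $k\in U_n$. We say $i$ is connected to $k$ (written $i\sim k$) if $i=k$ or there is a connection from $i$ to $k$. This is an equivalence relation on $I$; $[i]$ denotes the class of $i$ and $I/\sim$ the quotient set. *)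

theory Defs
  imports "HOL.Vector_Spaces"
begin

text \<open>
  A linear space over a field is a type together with a scalar multiplication satisfying
  \<^locale>\<open>vector_space\<close>. Bases are injective families over index sets, which may be empty or
  infinite.
\<close>

definition module_over ::
    "('f::field \<Rightarrow> 'v::ab_group_add \<Rightarrow> 'v) \<Rightarrow> ('f \<Rightarrow> 'w::ab_group_add \<Rightarrow> 'w) \<Rightarrow> ('v \<Rightarrow> 'w \<Rightarrow> 'v) \<Rightarrow> bool"
  where "module_over sV sW act \<longleftrightarrow>
    vector_space sV \<and> vector_space sW \<and>
    (\<forall>y. Vector_Spaces.linear sV sV (\<lambda>x. act x y)) \<and>
    (\<forall>x. Vector_Spaces.linear sW sV (\<lambda>y. act x y))"

definition submodule ::
    "('f::field \<Rightarrow> 'v::ab_group_add \<Rightarrow> 'v) \<Rightarrow> ('v \<Rightarrow> 'w \<Rightarrow> 'v) \<Rightarrow> 'v set \<Rightarrow> bool"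
  where "submodule sV act Y \<longleftrightarrow> module.subspace sV Y \<and> (\<forall>x\<in>Y. \<forall>y. act x y \<in> Y)"

definition is_basis ::
    "('f::field \<Rightarrow> 'v::ab_group_add \<Rightarrow> 'v) \<Rightarrow> 'v set \<Rightarrow> 'i set \<Rightarrow> ('i \<Rightarrow> 'v) \<Rightarrow> bool"
  where "is_basis s Y K u \<longleftrightarrow>
    inj_on u K \<and> \<not> module.dependent s (u ` K) \<and> module.span s (u ` K) = Y"

abbreviation line :: "('f::field \<Rightarrow> 'v::ab_group_add \<Rightarrow> 'v) \<Rightarrow> 'v \<Rightarrow> 'v set"
  where "line s x \<equiv> module.span s {x}"

text \<open>
  The family \<open>u\<close> over \<open>K\<close> is a multiplicative basis of \<open>Y\<close> with respect to the family \<open>w\<close>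
  over \<open>J\<close>; that \<open>w\<close> is a basis of the second space is a separate assumption.
\<close>

definition multiplicative_basis ::
    "('f::field \<Rightarrow> 'v::ab_group_add \<Rightarrow> 'v) \<Rightarrow> ('v \<Rightarrow> 'w \<Rightarrow> 'v) \<Rightarrow> 'j set \<Rightarrow> ('j \<Rightarrow> 'w) \<Rightarrow>
      'v set \<Rightarrow> 'i set \<Rightarrow> ('i \<Rightarrow> 'v) \<Rightarrow> bool"
  where "multiplicative_basis sV act J w Y K u \<longleftrightarrow>
    is_basis sV Y K u \<and>
    (\<forall>i\<in>K. \<forall>j\<in>J. act (u i) (w j) = 0 \<or>
      (act (u i) (w j) \<noteq> 0 \<and> (\<exists>!k. k \<in> K \<and> act (u i) (w j) \<in> line sV (u k))))"

definition inherited_multiplicative_basis ::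
    "('f::field \<Rightarrow> 'v::ab_group_add \<Rightarrow> 'v) \<Rightarrow> ('v \<Rightarrow> 'w \<Rightarrow> 'v) \<Rightarrow> 'j set \<Rightarrow> ('j \<Rightarrow> 'w) \<Rightarrow>
      'v set \<Rightarrow> 'v set \<Rightarrow> 'i set \<Rightarrow> ('i \<Rightarrow> 'v) \<Rightarrow> bool"
  where "inherited_multiplicative_basis sV act J w B Y K u \<longleftrightarrow>
    multiplicative_basis sV act J w Y K u \<and> u ` K \<subseteq> B"

definition subspace_sum ::
    "('f::field \<Rightarrow> 'v::ab_group_add \<Rightarrow> 'v) \<Rightarrow> 'a set \<Rightarrow> ('a \<Rightarrow> 'v set) \<Rightarrow> 'v set"
  where "subspace_sum s A U = module.span s (\<Union>a\<in>A. U a)"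

definition is_direct_sum ::
    "('f::field \<Rightarrow> 'v::ab_group_add \<Rightarrow> 'v) \<Rightarrow> 'v set \<Rightarrow> 'a set \<Rightarrow> ('a \<Rightarrow> 'v set) \<Rightarrow> bool"
  where "is_direct_sum s X A U \<longleftrightarrow>
    (\<forall>a\<in>A. module.subspace s (U a)) \<and>
    X = subspace_sum s A U \<and>
    (\<forall>a\<in>A. U a \<inter> subspace_sum s (A - {a}) U = {0})"

text \<open>
  The disjoint union of \<open>J\<close> with its set of barred copies is \<open>J <+> J\<close>: \<open>Inl j\<close> stands for
  \<open>j\<close> and \<open>Inr j\<close> for the barred symbol. For a multiplicative basis, the set returned for
  \<open>Inl j\<close> has at most one element.
\<close>

fun star ::
    "('f::field \<Rightarrow> 'v::ab_group_add \<Rightarrow> 'v) \<Rightarrow> ('v \<Rightarrow> 'w \<Rightarrow> 'v) \<Rightarrow> 'i set \<Rightarrow> ('i \<Rightarrow> 'v) \<Rightarrow> ('j \<Rightarrow> 'w) \<Rightarrow>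
      'i \<Rightarrow> 'j + 'j \<Rightarrow> 'i set"
  where
    "star sV act I v w i (Inl j) =
      (if act (v i) (w j) = 0 then {} else {k \<in> I. act (v i) (w j) \<in> line sV (v k)})"
  | "star sV act I v w i (Inr j) =
      {k \<in> I. act (v k) (w j) \<noteq> 0 \<and> act (v k) (w j) \<in> line sV (v i)}"

definition phi ::
    "('f::field \<Rightarrow> 'v::ab_group_add \<Rightarrow> 'v) \<Rightarrow> ('v \<Rightarrow> 'w \<Rightarrow> 'v) \<Rightarrow> 'i set \<Rightarrow> ('i \<Rightarrow> 'v) \<Rightarrow> ('j \<Rightarrow> 'w) \<Rightarrow>
      'i set \<Rightarrow> 'j + 'j \<Rightarrow> 'i set"
  where "phi sV act I v w U x = (\<Union>i\<in>U. star sV act I v w i x)"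

text \<open>The \<open>m\<close>-th member of a sequence, counted from 1, is the list entry \<open>xs ! (m - 1)\<close>.\<close>

primrec conn_set ::
    "('f::field \<Rightarrow> 'v::ab_group_add \<Rightarrow> 'v) \<Rightarrow> ('v \<Rightarrow> 'w \<Rightarrow> 'v) \<Rightarrow> 'i set \<Rightarrow> ('i \<Rightarrow> 'v) \<Rightarrow> ('j \<Rightarrow> 'w) \<Rightarrow>
      'i \<Rightarrow> ('j + 'j) list \<Rightarrow> nat \<Rightarrow> 'i set"
  where
    "conn_set sV act I v w i xs 0 = {i}"
  | "conn_set sV act I v w i xs (Suc m) = phi sV act I v w (conn_set sV act I v w i xs m) (xs ! m)"

definition connection ::
    "('f::field \<Rightarrow> 'v::ab_group_add \<Rightarrow> 'v) \<Rightarrow> ('v \<Rightarrow> 'w \<Rightarrow> 'v) \<Rightarrow> 'i set \<Rightarrow> ('i \<Rightarrow> 'v) \<Rightarrow>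
      'j set \<Rightarrow> ('j \<Rightarrow> 'w) \<Rightarrow> 'i \<Rightarrow> 'i \<Rightarrow> ('j + 'j) list \<Rightarrow> bool"
  where "connection sV act I v J w i k xs \<longleftrightarrow>
    i \<noteq> k \<and> length xs \<ge> 1 \<and> set xs \<subseteq> J <+> J \<and>
    (\<forall>m. 1 \<le> m \<and> m < length xs \<longrightarrow> conn_set sV act I v w i xs m \<noteq> {}) \<and>
    k \<in> conn_set sV act I v w i xs (length xs)"

definition connected_rel ::
    "('f::field \<Rightarrow> 'v::ab_group_add \<Rightarrow> 'v) \<Rightarrow> ('v \<Rightarrow> 'w \<Rightarrow> 'v) \<Rightarrow> 'i set \<Rightarrow> ('i \<Rightarrow> 'v) \<Rightarrow>
      'j set \<Rightarrow> ('j \<Rightarrow> 'w) \<Rightarrow> ('i \<times> 'i) set"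
  where "connected_rel sV act I v J w =
    {(i, k). i \<in> I \<and> k \<in> I \<and> (i = k \<or> (\<exists>xs. connection sV act I v J w i k xs))}"

text \<open>
  The sum defining \<open>V_class\<close> is direct as soon as \<open>v\<close> is injective with independent image;
  see \<open>V_class_direct_sum\<close> below.
\<close>

definition V_class ::
    "('f::field \<Rightarrow> 'v::ab_group_add \<Rightarrow> 'v) \<Rightarrow> ('i \<Rightarrow> 'v) \<Rightarrow> 'i set \<Rightarrow> 'v set"
  where "V_class sV v C = subspace_sum sV C (\<lambda>j. line sV (v j))"

lemma subspace_sum_lines:
  assumes "vector_space s"
  shows "subspace_sum s C (\<lambda>j. line s (v j)) = module.span s (v ` C)"
proof -
  interpret vector_space s by fact
  have "(\<Union>j\<in>C. span {v j}) \<subseteq> span (v ` C)"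
    by (intro UN_least span_mono) auto
  moreover have "v ` C \<subseteq> (\<Union>j\<in>C. span {v j})"
    using span_base by fastforce
  ultimately show ?thesis
    unfolding subspace_sum_def by (metis span_mono span_span subset_antisym)
qed

lemma V_class_direct_sum:
  assumes vs: "vector_space s"
    and inj: "inj_on v I" and indep: "\<not> module.dependent s (v ` I)" and C: "C \<subseteq> I"
  shows "is_direct_sum s (V_class s v C) C (\<lambda>j. line s (v j))"
proof -
  interpret vector_space s by fact
  have "x = 0" if a: "a \<in> C" and x: "x \<in> span {v a}" "x \<in> span (v ` (C - {a}))" for a x
  proof (rule ccontr)
    assume "x \<noteq> 0"
    from x(1) obtain c where c: "x = s c (v a)"
      by (auto simp: span_singleton)
    with \<open>x \<noteq> 0\<close> have "c \<noteq> 0" by auto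
    have "s (inverse c) x = v a"
      using c \<open>c \<noteq> 0\<close> by simp
    then have "v a \<in> span (v ` (C - {a}))"
      using span_scale[OF x(2), of "inverse c"] by simp
    moreover have "v ` (C - {a}) \<subseteq> v ` I - {v a}"
      using C a inj by (auto simp: inj_on_def)
    ultimately have "v a \<in> span (v ` I - {v a})"
      using span_mono by blast
    with indep a C show False
      by (auto simp: dependent_def)
  qed
  then show ?thesis
    by (auto simp: is_direct_sum_def V_class_def subspace_sum_lines[OF vs] subspace_span span_zero)
qed

lemma star_swap:
  assumes "i \<in> I" "k \<in> star sV act I v w i x"
  shows "k \<in> I \<and> i \<in> star sV act I v w k (case_sum Inr Inl x)"
  using assms by (cases x) (auto split: if_splits)

lemma conn_set_append:
  "m \<le> length xs \<Longrightarrow> conn_set sV act I v w i (xs @ ys) m = conn_set sV act I v w i xs m"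
  by (induction m) (auto simp: nth_append)

lemma conn_set_rtrancl:
  assumes "i \<in> I"
  shows "(\<exists>xs. set xs \<subseteq> J <+> J \<and> k \<in> conn_set sV act I v w i xs (length xs)) \<longleftrightarrow>
    (i, k) \<in> {(a, b). a \<in> I \<and> (\<exists>x\<in>J <+> J. b \<in> star sV act I v w a x)}\<^sup>*"
    (is "?L \<longleftrightarrow> (i, k) \<in> ?R\<^sup>*")
proof
  have "(i, k) \<in> ?R\<^sup>* \<and> k \<in> I"
    if "set xs \<subseteq> J <+> J" "k \<in> conn_set sV act I v w i xs (length xs)" for xs
    using that
  proof (induction xs arbitrary: k rule: rev_induct)
    case Nil
    with assms show ?case by simp
  next
    case (snoc x xs)
    then obtain l where l: "l \<in> conn_set sV act I v w i xs (length xs)"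
      and k: "k \<in> star sV act I v w l x"
      by (auto simp: conn_set_append phi_def)
    have "(i, l) \<in> ?R\<^sup>*" "l \<in> I"
      using snoc.IH[OF _ l] snoc.prems(1) by auto
    moreover from this have "(l, k) \<in> ?R"
      using k snoc.prems(1) by auto
    moreover have "k \<in> I"
      using star_swap[OF \<open>l \<in> I\<close> k] by simp
    ultimately show ?case by (blast intro: rtrancl_into_rtrancl)
  qed
  then show "(i, k) \<in> ?R\<^sup>*" if ?L using that by blast
next
  assume "(i, k) \<in> ?R\<^sup>*"
  then show ?L
  proof induction
    case base
    show ?case by (rule exI[of _ "[]"]) simp
  next
    case (step l k)
    then obtain xs x where *: "set xs \<subseteq> J <+> J" "l \<in> conn_set sV act I v w i xs (length xs)"
      "x \<in> J <+> J" "k \<in> star sV act I v w l x"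
      by auto
    then have "k \<in> conn_set sV act I v w i (xs @ [x]) (length (xs @ [x]))"
      by (auto simp: conn_set_append phi_def)
    with * show ?case
      by (intro exI[of _ "xs @ [x]"]) auto
  qed
qed

lemma conn_set_empty_mono:
  assumes "conn_set sV act I v w i xs m = {}" "m \<le> n"
  shows "conn_set sV act I v w i xs n = {}"
  using assms(2,1) by (induction rule: dec_induct) (auto simp: phi_def)

lemma connected_rel_rtrancl:
  "connected_rel sV act I v J w = {(i, k). i \<in> I \<and> k \<in> I \<and>
    (i, k) \<in> {(a, b). a \<in> I \<and> (\<exists>x\<in>J <+> J. b \<in> star sV act I v w a x)}\<^sup>*}"
proof -
  have "(\<exists>xs. connection sV act I v J w i k xs) \<longleftrightarrow>
      (\<exists>xs. set xs \<subseteq> J <+> J \<and> k \<in> conn_set sV act I v w i xs (length xs))" if "i \<noteq> k" for i k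
  proof
    assume "\<exists>xs. set xs \<subseteq> J <+> J \<and> k \<in> conn_set sV act I v w i xs (length xs)"
    then obtain xs where *: "set xs \<subseteq> J <+> J" "k \<in> conn_set sV act I v w i xs (length xs)"
      by blast
    have "xs \<noteq> []" using * \<open>i \<noteq> k\<close> by auto
    then have "length xs \<ge> 1" by (cases xs) auto
    moreover have "conn_set sV act I v w i xs m \<noteq> {}" if "m < length xs" for m
      using conn_set_empty_mono[of sV act I v w i xs m "length xs"] *(2) that by auto
    ultimately show "\<exists>xs. connection sV act I v J w i k xs"
      using * \<open>i \<noteq> k\<close> unfolding connection_def by blast
  qed (auto simp: connection_def)
  then have "i = k \<or> (\<exists>xs. connection sV act I v J w i k xs) \<longleftrightarrow>
      (i, k) \<in> {(a, b). a \<in> I \<and> (\<exists>x\<in>J <+> J. b \<in> star sV act I v w a x)}\<^sup>*"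
    if "i \<in> I" for i k
    using conn_set_rtrancl[OF that, of J k sV act v w] by (cases "i = k") simp_all
  then show ?thesis
    unfolding connected_rel_def by (intro Collect_cong) (simp add: case_prod_unfold cong: conj_cong)
qed

lemma equiv_connected_rel: "equiv I (connected_rel sV act I v J w)"
proof -
  define R where "R = {(a, b). a \<in> I \<and> (\<exists>x\<in>J <+> J. b \<in> star sV act I v w a x)}"
  have "sym R"
  proof (rule symI)
    fix a b assume "(a, b) \<in> R"
    then obtain x where x: "a \<in> I" "x \<in> J <+> J" "b \<in> star sV act I v w a x"
      by (auto simp: R_def)
    define x' where "x' = case_sum Inr Inl x"
    have x': "x' \<in> J <+> J"
      using x(2) by (auto simp: x'_def elim: PlusE)
    from star_swap[OF x(1,3)]
    have b: "b \<in> I" and a: "a \<in> star sV act I v w b x'"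
      by (simp_all add: x'_def)
    show "(b, a) \<in> R"
      unfolding R_def using b a x' by auto
  qed
  then have "sym (R\<^sup>*)" by (rule sym_rtrancl)
  moreover have "connected_rel sV act I v J w = {(i, k). i \<in> I \<and> k \<in> I \<and> (i, k) \<in> R\<^sup>*}"
    unfolding connected_rel_rtrancl R_def ..
  ultimately show ?thesis
    by (intro equivI refl_onI symI transI) (auto dest: symD intro: rtrancl_trans)
qed

end

theory Submission imports Defs begin

text \<open>
  The classes of the connection relation partition \<open>I\<close>. Since the basis is independent, spans of
  disjoint subfamilies meet only in 0, so any partition of the index set, whatever its origin,
  splits the space as a direct sum (\<open>V_class_partition_direct_sum\<close>). What is special about
  connection is that the action respects this splitting: if \<open>v\<^sub>i w\<^sub>j\<close> is a nonzero multiple of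
  \<open>v\<^sub>k\<close>, then the single symbol \<open>j\<close> connects \<open>i\<close> to \<open>k\<close>, so \<open>k\<close> lies in the class of \<open>i\<close>
  (\<open>connected_rel_if_product\<close>). Hence products of basis vectors never leave a class, which is the
  multiplicativity of the inherited basis, and by bilinearity the whole summand is a submodule
  (\<open>submodule_span\<close>). The barred symbols, which run products backwards, make the relation
  symmetric, so that it has classes at all.
\<close>

text \<open>
  A vector lying in both spans has one expansion over \<open>B\<close>, and its support must be contained in
  \<open>S\<close> as well as in \<open>T\<close>.
\<close>

lemma (in vector_space) span_Int_independent:
  assumes B: "independent B" and S: "S \<subseteq> B" and T: "T \<subseteq> B"
  shows "span S \<inter> span T = span (S \<inter> T)"
proof (intro subset_antisym subsetI)
  fix x assume x: "x \<in> span S \<inter> span T"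
  have supp: "b \<in> S \<inter> T" if "representation B x b \<noteq> 0" for b
  proof -
    have "representation S x = representation B x" "representation T x = representation B x"
      using x representation_extend[OF B _ S, of x] representation_extend[OF B _ T, of x]
      by simp_all
    then show ?thesis
      using that representation_ne_zero by (metis IntI)
  qed
  have "x \<in> span B"
    using x span_mono[OF S] by blast
  then have "x = (\<Sum>b | representation B x b \<noteq> 0. scale (representation B x b) b)"
    by (simp add: sum_nonzero_representation_eq[OF B])
  also have "\<dots> \<in> span (S \<inter> T)"
    using supp by (intro span_sum span_scale span_base) blast
  finally show "x \<in> span (S \<inter> T)" .
next
  fix x assume "x \<in> span (S \<inter> T)"
  then show "x \<in> span S \<inter> span T"
    using span_mono[OF Int_lower1, of S T] span_mono[OF Int_lower2, of S T] by (simp add: subset_iff)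
qed

lemma subspace_sum_V_class:
  assumes "vector_space s"
  shows "subspace_sum s A (V_class s v) = module.span s (v ` \<Union>A)"
proof -
  interpret vector_space s by fact
  have V: "V_class s v C = span (v ` C)" for C
    by (simp add: V_class_def subspace_sum_lines[OF assms])
  have "(\<Union>C\<in>A. span (v ` C)) \<subseteq> span (v ` \<Union>A)"
    by (intro UN_least span_mono) auto
  moreover have "v ` \<Union>A \<subseteq> (\<Union>C\<in>A. span (v ` C))"
    by (auto intro: span_base)
  ultimately show ?thesis
    unfolding subspace_sum_def V
    by (intro subset_antisym span_minimal[OF _ subspace_span] span_mono)
qed

text \<open>
  The sum of all summands but one is the span of the vectors indexed outside that one block, so
  directness reduces to two disjoint subfamilies of an independent family.
\<close>

lemma V_class_partition_direct_sum:
  assumes vs: "vector_space s" and basis: "is_basis s Y I v"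
    and un: "\<Union>P = I" and disj: "pairwise disjnt P"
  shows "is_direct_sum s Y P (V_class s v)"
proof -
  interpret vector_space s by fact
  have inj: "inj_on v I" and indep: "independent (v ` I)" and Y: "span (v ` I) = Y"
    using basis by (auto simp: is_basis_def)
  have V: "V_class s v C = span (v ` C)" for C
    by (simp add: V_class_def subspace_sum_lines[OF vs])
  have "span (v ` C) \<inter> span (v ` \<Union>(P - {C})) = {0}" if C: "C \<in> P" for C
  proof -
    have sub: "C \<subseteq> I" "\<Union>(P - {C}) \<subseteq> I"
      using C un by auto
    have "C \<inter> \<Union>(P - {C}) = {}"
      using disj C unfolding pairwise_def disjnt_def by blast
    then have "v ` C \<inter> v ` \<Union>(P - {C}) = {}"
      using inj_on_image_Int[OF inj sub] by simp
    then show ?thesis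
      using span_Int_independent[OF indep image_mono[OF sub(1)] image_mono[OF sub(2)]]
      by simp
  qed
  then show ?thesis
    unfolding is_direct_sum_def subspace_sum_V_class[OF vs] un Y V
    by (simp add: subspace_span)
qed

text \<open>
  Bilinearity extends closure under the action from products of spanning vectors to all products,
  one argument at a time: for fixed \<open>x \<in> X\<close> the \<open>z\<close> with \<open>act x z \<in> span X\<close> form a subspace, and
  then so do the \<open>x\<close> for which this holds for every \<open>z\<close>.
\<close>

lemma submodule_span:
  assumes M: "module_over sV sW act" and Z: "module.span sW Z = UNIV"
    and closed: "\<And>x z. x \<in> X \<Longrightarrow> z \<in> Z \<Longrightarrow> act x z \<in> module.span sV X"
  shows "submodule sV act (module.span sV X)"
proof -
  interpret V: vector_space sV using M by (simp add: module_over_def)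
  interpret W: vector_space sW using M by (simp add: module_over_def)
  have lin1: "Vector_Spaces.linear sV sV (\<lambda>x. act x y)" for y
    using M by (simp add: module_over_def)
  have lin2: "Vector_Spaces.linear sW sV (\<lambda>y. act x y)" for x
    using M by (simp add: module_over_def)
  have gen: "act x y \<in> V.span X" if x: "x \<in> X" for x y
  proof -
    interpret L: Vector_Spaces.linear sW sV "\<lambda>y. act x y" by (rule lin2)
    have "y \<in> W.span Z" using Z by simp
    then show ?thesis
      by (induction rule: W.span_induct_alt)
        (use closed[OF x] in \<open>auto simp: L.zero L.add L.scale V.span_zero V.span_add V.span_scale\<close>)
  qed
  have "act x y \<in> V.span X" if "x \<in> V.span X" for x y
  proof -
    interpret L: Vector_Spaces.linear sV sV "\<lambda>x. act x y" by (rule lin1)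
    show ?thesis using that
      by (induction rule: V.span_induct_alt)
        (auto simp: gen L.zero L.add L.scale V.span_zero V.span_add V.span_scale)
  qed
  then show ?thesis
    by (simp add: submodule_def)
qed

lemma connected_rel_if_product:
  assumes "i \<in> I" "k \<in> I" "j \<in> J"
    and "act (v i) (w j) \<noteq> 0" "act (v i) (w j) \<in> line sV (v k)"
  shows "(i, k) \<in> connected_rel sV act I v J w"
proof -
  have "k \<in> star sV act I v w i (Inl j)"
    using assms by simp
  then have "(i, k) \<in> {(a, b). a \<in> I \<and> (\<exists>x\<in>J <+> J. b \<in> star sV act I v w a x)}"
    using \<open>i \<in> I\<close> InlI[OF \<open>j \<in> J\<close>, of J] by (simp add: bexI[where x = "Inl j"])
  then show ?thesis
    unfolding connected_rel_rtrancl using assms(1,2) by (simp add: r_into_rtrancl)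
qed

lemma pairwise_disjnt_quotient: "equiv A r \<Longrightarrow> pairwise disjnt (A // r)"
  unfolding pairwise_def disjnt_def using quotient_disj[of A r] by blast

theorem theorem1:
  fixes sV :: "'f::field \<Rightarrow> 'v::ab_group_add \<Rightarrow> 'v"
    and sW :: "'f \<Rightarrow> 'w::ab_group_add \<Rightarrow> 'w"
    and act :: "'v \<Rightarrow> 'w \<Rightarrow> 'v"
    and I :: "'i set" and v :: "'i \<Rightarrow> 'v"
    and J :: "'j set" and w :: "'j \<Rightarrow> 'w"
  assumes "module_over sV sW act"
    and "is_basis sW UNIV J w"
    and "multiplicative_basis sV act J w UNIV I v"
  shows "is_direct_sum sV UNIV (I // connected_rel sV act I v J w) (V_class sV v) \<and>
    (\<forall>C \<in> I // connected_rel sV act I v J w.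
      submodule sV act (V_class sV v C) \<and>
      inherited_multiplicative_basis sV act J w (v ` I) (V_class sV v C) C v)"
proof (intro conjI ballI)
  let ?r = "connected_rel sV act I v J w"
  have vs: "vector_space sV"
    using assms(1) by (simp add: module_over_def)
  then interpret vector_space sV .
  have basis: "is_basis sV UNIV I v"
    using assms(3) by (simp add: multiplicative_basis_def)
  have eq: "equiv I ?r"
    by (rule equiv_connected_rel)
  show "is_direct_sum sV UNIV (I // ?r) (V_class sV v)"
    by (rule V_class_partition_direct_sum[OF vs basis])
      (rule Union_quotient[OF eq] pairwise_disjnt_quotient[OF eq])+
  fix C assume C: "C \<in> I // ?r"
  have CI: "C \<subseteq> I"
    using in_quotient_imp_subset[OF eq C] .
  have V: "V_class sV v C = span (v ` C)"
    by (simp add: V_class_def subspace_sum_lines[OF vs])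
  have product: "act (v i) (w j) = 0 \<or>
      (act (v i) (w j) \<noteq> 0 \<and> (\<exists>!k. k \<in> C \<and> act (v i) (w j) \<in> line sV (v k)))"
    if i: "i \<in> C" and j: "j \<in> J" for i j
  proof (cases "act (v i) (w j) = 0")
    case False
    have iI: "i \<in> I" using i CI by blast
    have ex1: "\<exists>!k. k \<in> I \<and> act (v i) (w j) \<in> line sV (v k)"
      using assms(3) iI j False unfolding multiplicative_basis_def by blast
    have "k \<in> C" if k: "k \<in> I" "act (v i) (w j) \<in> line sV (v k)" for k
    proof (rule in_quotient_imp_closed[OF eq C i])
      show "(i, k) \<in> ?r"
        by (rule connected_rel_if_product[where j = j]) (fact iI k j False)+
    qed
    with ex1 CI False show ?thesis by blast
  qed simp
  have "act x z \<in> span (v ` C)" if xz': "x \<in> v ` C" "z \<in> w ` J" for x z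
  proof -
    obtain i j where ij: "i \<in> C" "j \<in> J" and xz: "x = v i" "z = w j"
      using xz' by blast
    show ?thesis
    proof (cases "act (v i) (w j) = 0")
      case False
      then obtain k where "k \<in> C" "act (v i) (w j) \<in> line sV (v k)"
        using product[OF ij] by blast
      moreover have "line sV (v k) \<subseteq> span (v ` C)"
        using \<open>k \<in> C\<close> by (intro span_mono) simp
      ultimately show ?thesis using xz by blast
    qed (simp add: xz span_zero)
  qed
  then show "submodule sV act (V_class sV v C)"
    using assms(1,2) unfolding V is_basis_def by (intro submodule_span) auto
  have "is_basis sV (V_class sV v C) C v"
    using basis CI unfolding V is_basis_def
    by (meson image_mono independent_mono inj_on_subset)
  then show "inherited_multiplicative_basis sV act J w (v ` I) (V_class sV v C) C v"
    using product CI
    unfolding inherited_multiplicative_basis_def multiplicative_basis_def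
    by (simp add: image_mono)
qed

end
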